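(* Let $f:\mathbb{R}^n\to\mathbb{R}$ be $L$-smooth and $\mu$-strongly convex with $L>\mu>0$, let $g:\mathbb{R}^n\to(-\infty,\infty]$ be closed, proper and convex, let $F=f+g$, let $x^\star$ be the unique minimizer of $F$ and $F^\star=F(x^\star)$. Let $\{x_k\}$ and $\{y_k\}$ be the sequences generated by the gradient restarted APG method (see context) with step size $0<s<1/L$. Then, for all $k\ge1$, $$\|x_k-x^\star\|^2\le(1-\mu s)\rho^{k-1}\|x_0-x^\star\|^2\qquad\text{with}\quad\rho=1-\frac{(1-Ls)\mu s}{3}.$$ Moreover, the sequence $\{y_k\}$ and the function value sequence $\{F(x_k)\}$ also converge R-linearly with the same rate, i.e. there is a constant $C$ such that $\|y_k-x^\star\|^2\le C\rho^k$ and $F(x_k)-F^\star\le C\rho^k$ for all $k\ge1$.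
   Context: $\|\cdot\|$ is the Euclidean norm. $f$ is $L$-smooth if it is differentiable with $L$-Lipschitz gradient; $f$ is $\mu$-strongly convex if $f-\frac{\mu}{2}\|\cdot\|^2$ is convex. Proximal map: $\mathrm{prox}_{sg}(y)=\arg\min_{z\in\mathbb{R}^n}\{\frac12\|y-z\|^2+s\,g(z)\}$. Gradient restarted APG method. Input: initial point $x_0=y_0\in\mathbb{R}^n$, step size $s>0$, counter $j=1$, and a sequence $\{t_k\}_{k\ge1}$ with $t_1=1$, $t_{k+1}>t_k$, $t_k\to\infty$ and $t_{k+1}^2-t_{k+1}\le t_k^2$ for all $k\ge1$. For $k=1,2,\dots$: (i) set $z_k=\mathrm{prox}_{sg}(y_{k-1}-s\nabla f(y_{k-1}))$ and $y_k=z_k+\frac{t_j-1}{t_{j+1}}(z_k-x_{k-1})$; (ii) if $\langle z_k-x_{k-1},\,y_{k-1}-z_k\rangle>0$ (restart), set instead $x_k=\mathrm{prox}_{sg}(x_{k-1}-s\nabla f(x_{k-1}))$, $y_k=x_k$, and reset $j\leftarrow1$; (iii) otherwise set $x_k=z_k$ (keeping $y_k$ from (i)) and $j\leftarrow j+1$. *)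

theory Defs
  imports "HOL-Analysis.Analysis"
begin

definition gradient :: "('a::real_inner \<Rightarrow> real) \<Rightarrow> 'a \<Rightarrow> 'a" where
  "gradient f x = (THE D. GDERIV f x :> D)"

definition smooth_with :: "real \<Rightarrow> ('a::real_inner \<Rightarrow> real) \<Rightarrow> bool" where
  "smooth_with L f \<longleftrightarrow> (\<forall>x. f differentiable (at x)) \<and> lipschitz_on L UNIV (gradient f)"

definition strongly_convex :: "real \<Rightarrow> ('a::real_inner \<Rightarrow> real) \<Rightarrow> bool" where
  "strongly_convex \<mu> f \<longleftrightarrow> convex_on UNIV (\<lambda>x. f x - \<mu> / 2 * (norm x)\<^sup>2)"

(* Extended-valued functions. The epigraph consists of pairs with a real second
   component; convexity and closedness of the function are those of the epigraph. *)

definition ereal_epigraph :: "('a \<Rightarrow> ereal) \<Rightarrow> ('a \<times> real) set" where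
  "ereal_epigraph g = {(x, r). g x \<le> ereal r}"

definition proper_fun :: "('a \<Rightarrow> ereal) \<Rightarrow> bool" where
  "proper_fun g \<longleftrightarrow> (\<forall>x. g x \<noteq> -\<infinity>) \<and> (\<exists>x. g x \<noteq> \<infinity>)"

definition convex_fun :: "('a::real_vector \<Rightarrow> ereal) \<Rightarrow> bool" where
  "convex_fun g \<longleftrightarrow> convex (ereal_epigraph g)"

definition closed_fun :: "('a::topological_space \<Rightarrow> ereal) \<Rightarrow> bool" where
  "closed_fun g \<longleftrightarrow> closed (ereal_epigraph g)"

definition composite :: "('a \<Rightarrow> real) \<Rightarrow> ('a \<Rightarrow> ereal) \<Rightarrow> 'a \<Rightarrow> ereal" where
  "composite f g x = ereal (f x) + g x"

(* arg_min is an unspecified point if the minimum is not attained. For s > 0 and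
   g closed, proper and convex the minimizer exists and is unique. *)

definition prox :: "real \<Rightarrow> ('a::real_inner \<Rightarrow> ereal) \<Rightarrow> 'a \<Rightarrow> 'a" where
  "prox s g y = arg_min (\<lambda>z. ereal (1 / 2 * (norm (y - z))\<^sup>2) + ereal s * g z) (\<lambda>_. True)"

definition prox_grad ::
  "('a::real_inner \<Rightarrow> real) \<Rightarrow> ('a \<Rightarrow> ereal) \<Rightarrow> real \<Rightarrow> 'a \<Rightarrow> 'a" where
  "prox_grad f g s y = prox s g (y - s *\<^sub>R gradient f y)"

(* The state after k iterations is (x_k, y_k, j), where j is the value of the counter
   with which iteration k + 1 starts. *)

definition apg_step ::
  "('a::real_inner \<Rightarrow> real) \<Rightarrow> ('a \<Rightarrow> ereal) \<Rightarrow> real \<Rightarrow> (nat \<Rightarrow> real) \<Rightarrow>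
    'a \<times> 'a \<times> nat \<Rightarrow> 'a \<times> 'a \<times> nat" where
  "apg_step f g s t = (\<lambda>(x, y, j).
     let z = prox_grad f g s y in
       if (z - x) \<bullet> (y - z) > 0
       then (prox_grad f g s x, prox_grad f g s x, 1)
       else (z, z + ((t j - 1) / t (j + 1)) *\<^sub>R (z - x), j + 1))"

primrec apg_state ::
  "('a::real_inner \<Rightarrow> real) \<Rightarrow> ('a \<Rightarrow> ereal) \<Rightarrow> real \<Rightarrow> (nat \<Rightarrow> real) \<Rightarrow> 'a \<Rightarrow>
    nat \<Rightarrow> 'a \<times> 'a \<times> nat" where
  "apg_state f g s t x0 0 = (x0, x0, 1)"
| "apg_state f g s t x0 (Suc k) = apg_step f g s t (apg_state f g s t x0 k)"

definition apg_x ::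
  "('a::real_inner \<Rightarrow> real) \<Rightarrow> ('a \<Rightarrow> ereal) \<Rightarrow> real \<Rightarrow> (nat \<Rightarrow> real) \<Rightarrow> 'a \<Rightarrow> nat \<Rightarrow> 'a" where
  "apg_x f g s t x0 k = fst (apg_state f g s t x0 k)"

definition apg_y ::
  "('a::real_inner \<Rightarrow> real) \<Rightarrow> ('a \<Rightarrow> ereal) \<Rightarrow> real \<Rightarrow> (nat \<Rightarrow> real) \<Rightarrow> 'a \<Rightarrow> nat \<Rightarrow> 'a" where
  "apg_y f g s t x0 k = fst (snd (apg_state f g s t x0 k))"

(* Only the terms t_k with k >= 1 are used by the method; t 0 is unconstrained. *)

definition apg_params :: "(nat \<Rightarrow> real) \<Rightarrow> bool" where
  "apg_params t \<longleftrightarrow> t 1 = 1 \<and>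
     (\<forall>k\<ge>1. t k < t (k + 1) \<and> (t (k + 1))\<^sup>2 - t (k + 1) \<le> (t k)\<^sup>2) \<and>
     filterlim t at_top sequentially"

end

theory Submission
  imports Defs
begin

text \<open>
  Write $q = \mu s$, $a = 1 - Ls$, $v(u) = 2s(F(u) - F^\star)$ and let $T$ be the proximal
  gradient map. Combining the descent inequality
  $v(Ty) - v(u) \le (1-q)\|y-u\|^2 - \|Ty-u\|^2 - a\|Ty-y\|^2$ at $u = x_{k-1}$ and $u = x^\star$
  as for FISTA, with all quadratic terms kept, shows that the energy
  $E = t_j^2 v(x_k) + \|t_j x_k - (t_j-1)x_{k-1} - x^\star\|^2$ decreases by an amount that
  dominates $\frac{aq}{3}E$, so it contracts by $\rho$ between restarts. The distance to
  $x^\star$ then contracts too: either $\|x_k-x^\star\|^2 \le E$, or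
  $(1+4q)\|x_k-x^\star\|^2 \le \|x_{k-1}-x^\star\|^2$, and $(1+4q)\rho \ge 1$. A restart is a
  plain proximal gradient step, which contracts by $1-q \le \rho$ and starts a new energy with
  $t_1 = 1$.
\<close>

section \<open>Smooth and strongly convex functions\<close>

text \<open>\<open>gradient\<close> is a definite description, so existence and uniqueness are both
  required. The vector of the values of the derivative on \<open>Basis\<close> represents it, and
  derivatives are unique.\<close>

lemma GDERIV_gradient:
  fixes f :: "'a::euclidean_space \<Rightarrow> real"
  assumes "f differentiable (at x)"
  shows "GDERIV f x :> gradient f x"
proof -
  obtain f' where f': "(f has_derivative f') (at x)"
    using assms by (auto simp: differentiable_def)
  have lin: "linear f'"
    using f' has_derivative_linear by blast
  define D where "D = (\<Sum>b\<in>Basis. f' b *\<^sub>R b)"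
  have "f' h = h \<bullet> D" for h
  proof -
    have "f' h = f' (\<Sum>b\<in>Basis. (h \<bullet> b) *\<^sub>R b)"
      by (simp add: euclidean_representation)
    also have "\<dots> = (\<Sum>b\<in>Basis. (h \<bullet> b) * f' b)"
      using lin by (simp add: linear_sum linear_cmul)
    also have "\<dots> = h \<bullet> D"
      unfolding D_def by (simp add: inner_sum_right mult.commute)
    finally show ?thesis .
  qed
  then have "f' = (\<lambda>h. h \<bullet> D)"
    by (rule ext)
  with f' have D: "GDERIV f x :> D"
    by (simp add: gderiv_def)
  have "D' = D" if "GDERIV f x :> D'" for D'
  proof -
    have "(\<lambda>h. h \<bullet> D') = (\<lambda>h. h \<bullet> D)"
      using that D unfolding gderiv_def by (rule has_derivative_unique)
    then have "\<forall>h. h \<bullet> D' = h \<bullet> D"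
      by (simp add: fun_eq_iff)
    then show ?thesis
      by (rule vector_eq_ldot[THEN iffD1])
  qed
  then show ?thesis
    unfolding gradient_def by (rule theI[of "\<lambda>D. GDERIV f x :> D", OF D])
qed

lemma GDERIV_along_line:
  fixes f :: "'a::real_inner \<Rightarrow> real"
  assumes "GDERIV f (y + \<tau> *\<^sub>R v) :> D"
  shows "((\<lambda>\<tau>. f (y + \<tau> *\<^sub>R v)) has_field_derivative D \<bullet> v) (at \<tau>)"
proof -
  have "((\<lambda>\<tau>. y + \<tau> *\<^sub>R v) has_derivative (\<lambda>h. h *\<^sub>R v)) (at \<tau>)"
    by (auto intro!: derivative_eq_intros)
  from has_derivative_compose[OF this assms[unfolded gderiv_def]]
  show ?thesis
    unfolding has_field_derivative_def
    by (simp add: inner_commute mult.commute[of _ "D \<bullet> v"])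
qed

text \<open>The descent lemma, without integration: along the segment from \<open>y\<close> to
  \<open>z\<close>, the auxiliary \<open>\<phi>\<close> has nonpositive derivative by Cauchy-Schwarz
  and the Lipschitz bound, and \<open>\<phi> 1 \<le> \<phi> 0\<close> is the claim.\<close>

lemma smooth_upper_bound:
  fixes f :: "'a::euclidean_space \<Rightarrow> real"
  assumes "smooth_with L f"
  shows "f z \<le> f y + gradient f y \<bullet> (z - y) + L / 2 * (norm (z - y))\<^sup>2"
proof -
  define v where "v = z - y"
  define \<phi> where "\<phi> \<tau> = f (y + \<tau> *\<^sub>R v) - \<tau> * (gradient f y \<bullet> v) - L / 2 * \<tau>\<^sup>2 * (norm v)\<^sup>2" for \<tau>
  have "\<phi> 1 \<le> \<phi> 0"
  proof (rule DERIV_nonpos_imp_nonincreasing[of 0 1 \<phi>])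
    fix \<tau> :: real
    assume \<tau>: "0 \<le> \<tau>" "\<tau> \<le> 1"
    let ?w = "y + \<tau> *\<^sub>R v"
    have "GDERIV f ?w :> gradient f ?w"
      using assms by (intro GDERIV_gradient) (simp add: smooth_with_def)
    note d = GDERIV_along_line[OF this]
    have "(\<phi> has_field_derivative
        gradient f ?w \<bullet> v - gradient f y \<bullet> v - L * \<tau> * (norm v)\<^sup>2) (at \<tau>)"
      unfolding \<phi>_def by (rule derivative_eq_intros d refl | simp)+
    moreover have "gradient f ?w \<bullet> v - gradient f y \<bullet> v \<le> L * \<tau> * (norm v)\<^sup>2"
    proof -
      have "gradient f ?w \<bullet> v - gradient f y \<bullet> v = (gradient f ?w - gradient f y) \<bullet> v"
        by (simp add: inner_diff_left)
      also have "\<dots> \<le> norm (gradient f ?w - gradient f y) * norm v"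
        by (rule norm_cauchy_schwarz)
      also have "norm (gradient f ?w - gradient f y) \<le> L * norm (?w - y)"
        using assms lipschitz_on_normD unfolding smooth_with_def by blast
      also have "L * norm (?w - y) * norm v = L * \<tau> * (norm v)\<^sup>2"
        using \<tau> by (simp add: power2_eq_square)
      finally show ?thesis
        by (simp add: mult_right_mono)
    qed
    ultimately show "\<exists>d. (\<phi> has_field_derivative d) (at \<tau>) \<and> d \<le> 0"
      by (metis diff_le_0_iff_le)
  qed simp
  then show ?thesis
    by (simp add: \<phi>_def v_def)
qed

text \<open>On the line through \<open>y\<close> and \<open>u\<close> the convex function
  \<open>h\<close> lies above its tangent at \<open>y\<close>. Adding back the subtracted quadratic
  leaves exactly its second-order remainder, a multiple of the squared distance from
  \<open>y\<close> to \<open>u\<close>.\<close>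

lemma strongly_convex_lower_bound:
  fixes f :: "'a::euclidean_space \<Rightarrow> real"
  assumes "f differentiable (at y)" and "strongly_convex \<mu> f"
  shows "f u \<ge> f y + gradient f y \<bullet> (u - y) + \<mu> / 2 * (norm (u - y))\<^sup>2"
proof -
  define v where "v = u - y"
  define h where "h x = f x - \<mu> / 2 * (norm x)\<^sup>2" for x
  define \<phi> where "\<phi> \<tau> = h (y + \<tau> *\<^sub>R v)" for \<tau>
  have h: "convex_on UNIV h"
    using assms(2) unfolding strongly_convex_def h_def[abs_def] .
  have conv: "convex_on UNIV \<phi>"
    unfolding \<phi>_def
  proof (rule convex_onI)
    fix \<theta> a b :: real
    assume "0 < \<theta>" "\<theta> < 1"
    have *: "y + ((1 - \<theta>) *\<^sub>R a + \<theta> *\<^sub>R b) *\<^sub>R v = (1 - \<theta>) *\<^sub>R (y + a *\<^sub>R v) + \<theta> *\<^sub>R (y + b *\<^sub>R v)"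
      by (simp add: algebra_simps)
    show "h (y + ((1 - \<theta>) *\<^sub>R a + \<theta> *\<^sub>R b) *\<^sub>R v)
        \<le> (1 - \<theta>) * h (y + a *\<^sub>R v) + \<theta> * h (y + b *\<^sub>R v)"
      unfolding * using \<open>0 < \<theta>\<close> \<open>\<theta> < 1\<close> by (intro convex_onD[OF h]) auto
  qed simp
  have "GDERIV f (y + 0 *\<^sub>R v) :> gradient f y"
    by (simp only: scaleR_zero_left add_0_right GDERIV_gradient[OF assms(1)])
  note d = GDERIV_along_line[OF this]
  have \<phi>_eq: "\<phi> = (\<lambda>\<tau>. f (y + \<tau> *\<^sub>R v)
      - \<mu> / 2 * ((norm y)\<^sup>2 + 2 * \<tau> * (y \<bullet> v) + \<tau>\<^sup>2 * (norm v)\<^sup>2))"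
  proof
    fix \<tau>
    have "(norm (y + \<tau> *\<^sub>R v))\<^sup>2 = (norm y)\<^sup>2 + 2 * \<tau> * (y \<bullet> v) + \<tau>\<^sup>2 * (norm v)\<^sup>2"
      unfolding power2_norm_eq_inner
      by (simp add: inner_add_left inner_add_right inner_commute power2_eq_square)
    then show "\<phi> \<tau> = f (y + \<tau> *\<^sub>R v)
      - \<mu> / 2 * ((norm y)\<^sup>2 + 2 * \<tau> * (y \<bullet> v) + \<tau>\<^sup>2 * (norm v)\<^sup>2)"
      by (simp add: \<phi>_def h_def)
  qed
  have "(\<phi> has_field_derivative (gradient f y \<bullet> v - \<mu> * (y \<bullet> v))) (at 0)"
    unfolding \<phi>_eq by (rule derivative_eq_intros d refl | simp)+
  then have "\<phi> 1 - \<phi> 0 \<ge> (gradient f y \<bullet> v - \<mu> * (y \<bullet> v)) * (1 - 0)"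
    using convex_on_imp_above_tangent[OF conv, of 0 1] by simp
  then have "f u \<ge> f y + gradient f y \<bullet> v + \<mu> / 2 * (norm v)\<^sup>2"
    unfolding \<phi>_eq by (simp add: v_def algebra_simps)
  then show ?thesis
    by (simp add: v_def)
qed

section \<open>The proximal map\<close>

text \<open>Working on the epigraph turns the extended-valued objective into a continuous real
  function on a closed set. Coercivity is a hypothesis, so that the caller can derive it from the
  lower bound on the composite objective.\<close>

lemma prox_objective_attained:
  fixes g :: "'a::euclidean_space \<Rightarrow> ereal"
  assumes "closed_fun g" and "0 < s" and "0 < \<alpha>" and "(u1, r1) \<in> ereal_epigraph g"
    and coercive: "\<And>u r. (u, r) \<in> ereal_epigraph g \<Longrightarrow>
      c + \<alpha> * (norm (u - p))\<^sup>2 \<le> 1 / 2 * (norm (y - u))\<^sup>2 + s * r"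
  obtains z r where "(z, r) \<in> ereal_epigraph g"
    and "\<And>u r'. (u, r') \<in> ereal_epigraph g \<Longrightarrow>
      1 / 2 * (norm (y - z))\<^sup>2 + s * r \<le> 1 / 2 * (norm (y - u))\<^sup>2 + s * r'"
proof -
  define \<psi> where "\<psi> w = 1 / 2 * (norm (y - fst w))\<^sup>2 + s * snd w" for w :: "'a \<times> real"
  define M where "M = \<psi> (u1, r1)"
  define K where "K = ereal_epigraph g \<inter> {w. \<psi> w \<le> M}"
  define R where "R = sqrt ((M - c) / \<alpha>)"
  have cont: "continuous_on A \<psi>" for A
    unfolding \<psi>_def by (intro continuous_intros)
  have "closed K"
    using assms(1) unfolding K_def closed_fun_def
    by (intro closed_Int closed_Collect_le cont) auto
  \<comment> \<open>Coercivity below level \<open>M\<close> confines \<open>u\<close> to a ball.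
    Then \<open>norm (y - u)\<close> is bounded too, which bounds the height \<open>r\<close> from
    below; the level \<open>M\<close> bounds it from above.\<close>
  moreover have "K \<subseteq> cball p R \<times> {(c - 1 / 2 * (norm (y - p) + R)\<^sup>2) / s .. M / s}"
  proof clarify
    fix u r
    assume ur: "(u, r) \<in> K"
    then have 1: "c + \<alpha> * (norm (u - p))\<^sup>2 \<le> 1 / 2 * (norm (y - u))\<^sup>2 + s * r"
      and 2: "1 / 2 * (norm (y - u))\<^sup>2 + s * r \<le> M"
      using coercive by (auto simp: K_def \<psi>_def)
    have "(norm (u - p))\<^sup>2 \<le> (M - c) / \<alpha>"
      using 1 2 \<open>0 < \<alpha>\<close> by (simp add: field_simps)
    then have nR: "norm (u - p) \<le> R"
      unfolding R_def by (rule real_le_rsqrt)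
    have "norm (y - u) \<le> norm (y - p) + R"
      using nR norm_triangle_ineq4[of "y - p" "u - p"] by simp
    then have "(norm (y - u))\<^sup>2 \<le> (norm (y - p) + R)\<^sup>2"
      by (simp add: power_mono)
    moreover have "0 \<le> \<alpha> * (norm (u - p))\<^sup>2"
      using \<open>0 < \<alpha>\<close> by simp
    ultimately have "c - 1 / 2 * (norm (y - p) + R)\<^sup>2 \<le> s * r" "s * r \<le> M"
      using 1 2 zero_le_power2[of "norm (y - u)"] by linarith+
    then show "u \<in> cball p R \<and> r \<in> {(c - 1 / 2 * (norm (y - p) + R)\<^sup>2) / s .. M / s}"
      using nR \<open>0 < s\<close> by (simp add: dist_norm norm_minus_commute field_simps)
  qed
  then have "bounded K"
    by (rule bounded_subset[rotated]) (intro bounded_Times bounded_cball bounded_closed_interval)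
  ultimately have "compact K"
    by (simp add: compact_eq_bounded_closed)
  moreover have "(u1, r1) \<in> K"
    using assms(4) by (simp add: K_def M_def)
  ultimately obtain w where w: "w \<in> K" "\<And>w'. w' \<in> K \<Longrightarrow> \<psi> w \<le> \<psi> w'"
    using continuous_attains_inf[of K \<psi>] cont by blast
  show thesis
  proof (rule that)
    show "(fst w, snd w) \<in> ereal_epigraph g"
      using w by (simp add: K_def)
    fix u r'
    assume "(u, r') \<in> ereal_epigraph g"
    then have "\<psi> w \<le> \<psi> (u, r')"
      using w by (cases "\<psi> (u, r') \<le> M") (auto simp: K_def)
    then show "1 / 2 * (norm (y - fst w))\<^sup>2 + s * snd w \<le> 1 / 2 * (norm (y - u))\<^sup>2 + s * r'"
      by (simp add: \<psi>_def)
  qed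
qed

text \<open>The first-order condition that \<open>y - z\<close> is a subgradient of
  \<open>s * g\<close> at \<open>z\<close>, in terms of epigraph heights. Moving a fraction
  \<open>\<theta>\<close> towards \<open>(u, r')\<close> costs only a second-order term, so dividing
  by \<open>\<theta>\<close> and letting it tend to 0 gives the inequality.\<close>

lemma prox_variational:
  fixes g :: "'a::real_inner \<Rightarrow> ereal"
  assumes "convex_fun g" and "0 < s"
    and z: "(z, r) \<in> ereal_epigraph g" and u: "(u, r') \<in> ereal_epigraph g"
    and min: "\<And>u r'. (u, r') \<in> ereal_epigraph g \<Longrightarrow>
      1 / 2 * (norm (y - z))\<^sup>2 + s * r \<le> 1 / 2 * (norm (y - u))\<^sup>2 + s * r'"
  shows "s * r + (y - z) \<bullet> (u - z) \<le> s * r'"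
proof -
  define c where "c = s * r + (y - z) \<bullet> (u - z) - s * r'"
  have "c \<le> \<theta> * ((norm (u - z))\<^sup>2 / 2)" if "0 < \<theta>" "\<theta> < 1" for \<theta>
  proof -
    have "(1 - \<theta>) *\<^sub>R (z, r) + \<theta> *\<^sub>R (u, r') \<in> ereal_epigraph g"
      using assms(1) z u that unfolding convex_fun_def by (intro convexD) auto
    then have "(z + \<theta> *\<^sub>R (u - z), (1 - \<theta>) * r + \<theta> * r') \<in> ereal_epigraph g"
      by (simp add: algebra_simps)
    note m = min[OF this]
    have "(norm (y - (z + \<theta> *\<^sub>R (u - z))))\<^sup>2
      = (norm (y - z))\<^sup>2 - 2 * \<theta> * ((y - z) \<bullet> (u - z)) + \<theta>\<^sup>2 * (norm (u - z))\<^sup>2"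
    proof -
      have "(norm (p - \<theta> *\<^sub>R e))\<^sup>2 = (norm p)\<^sup>2 - 2 * \<theta> * (p \<bullet> e) + \<theta>\<^sup>2 * (norm e)\<^sup>2"
        for p e :: 'a
        unfolding power2_norm_eq_inner by (simp add: inner_diff_left inner_diff_right inner_commute
            power2_eq_square)
      from this[of "y - z" "u - z"] show ?thesis
        by (simp add: diff_diff_eq)
    qed
    with m have "\<theta> * c \<le> \<theta> * (\<theta> * ((norm (u - z))\<^sup>2 / 2))"
      by (simp add: c_def power2_eq_square algebra_simps)
    then show ?thesis
      using that by simp
  qed
  then have "eventually (\<lambda>\<theta>. c \<le> \<theta> * ((norm (u - z))\<^sup>2 / 2)) (at_right 0)"
    unfolding eventually_at_right[OF zero_less_one] by (intro exI[of _ 1]) auto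
  moreover have "((\<lambda>\<theta>. \<theta> * ((norm (u - z))\<^sup>2 / 2)) \<longlongrightarrow> 0 * ((norm (u - z))\<^sup>2 / 2)) (at_right 0)"
    by (intro tendsto_intros)
  ultimately have "c \<le> 0"
    using tendsto_lowerbound[of "\<lambda>\<theta>. \<theta> * ((norm (u - z))\<^sup>2 / 2)" 0 "at_right 0" c] by simp
  then show ?thesis
    by (simp add: c_def)
qed

lemma ereal_epigraph_iff:
  assumes "proper_fun g"
  shows "(u, r) \<in> ereal_epigraph g \<longleftrightarrow> g u \<noteq> \<infinity> \<and> real_of_ereal (g u) \<le> r"
  using assms unfolding ereal_epigraph_def proper_fun_def by (cases "g u") auto

text \<open>Shows that the choice made by \<open>arg_min\<close> is a genuine minimizer: once some
  point attains the minimum, the chosen point satisfies \<open>is_arg_min\<close> as well.\<close>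

lemma prox_minimizes:
  fixes g :: "'a::euclidean_space \<Rightarrow> ereal"
  assumes "closed_fun g" and proper: "proper_fun g" and "0 < s" and "0 < \<alpha>"
    and coercive: "\<And>u. g u \<noteq> \<infinity> \<Longrightarrow>
      c + \<alpha> * (norm (u - p))\<^sup>2 \<le> 1 / 2 * (norm (y - u))\<^sup>2 + s * real_of_ereal (g u)"
  shows "g (prox s g y) \<noteq> \<infinity>"
    and "\<And>u. g u \<noteq> \<infinity> \<Longrightarrow>
      1 / 2 * (norm (y - prox s g y))\<^sup>2 + s * real_of_ereal (g (prox s g y))
        \<le> 1 / 2 * (norm (y - u))\<^sup>2 + s * real_of_ereal (g u)"
proof -
  define \<Phi> where "\<Phi> u = ereal (1 / 2 * (norm (y - u))\<^sup>2) + ereal s * g u" for u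
  note epi = ereal_epigraph_iff[OF proper]
  have \<Phi>: "\<Phi> u = (if g u = \<infinity> then \<infinity>
      else ereal (1 / 2 * (norm (y - u))\<^sup>2 + s * real_of_ereal (g u)))" for u
    using proper \<open>0 < s\<close> unfolding \<Phi>_def proper_fun_def by (cases "g u") auto
  obtain u1 where u1: "g u1 \<noteq> \<infinity>"
    using proper by (auto simp: proper_fun_def)
  obtain z r where zr: "(z, r) \<in> ereal_epigraph g"
    and min: "\<And>u r'. (u, r') \<in> ereal_epigraph g \<Longrightarrow>
      1 / 2 * (norm (y - z))\<^sup>2 + s * r \<le> 1 / 2 * (norm (y - u))\<^sup>2 + s * r'"
  proof (rule prox_objective_attained)
    show "(u1, real_of_ereal (g u1)) \<in> ereal_epigraph g"
      using u1 by (simp add: epi)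
    fix u r
    assume "(u, r) \<in> ereal_epigraph g"
    then have "g u \<noteq> \<infinity>" "s * real_of_ereal (g u) \<le> s * r"
      using \<open>0 < s\<close> by (auto simp: epi)
    then show "c + \<alpha> * (norm (u - p))\<^sup>2 \<le> 1 / 2 * (norm (y - u))\<^sup>2 + s * r"
      using coercive[of u] by linarith
  qed (use assms in auto)
  have "\<Phi> z \<le> \<Phi> u" for u
  proof (cases "g u = \<infinity>")
    case False
    then have "1 / 2 * (norm (y - z))\<^sup>2 + s * r \<le> 1 / 2 * (norm (y - u))\<^sup>2 + s * real_of_ereal (g u)"
      using min[of u "real_of_ereal (g u)"] by (simp add: epi)
    moreover have "g z \<noteq> \<infinity>" "s * real_of_ereal (g z) \<le> s * r"
      using zr \<open>0 < s\<close> by (auto simp: epi)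
    ultimately show ?thesis
      using False by (simp add: \<Phi>)
  qed (simp add: \<Phi>)
  then have "is_arg_min \<Phi> (\<lambda>_. True) z"
    by (simp add: is_arg_min_def not_less)
  then have "is_arg_min \<Phi> (\<lambda>_. True) (prox s g y)"
    unfolding prox_def \<Phi>_def[abs_def, symmetric] arg_min_def by (rule someI)
  then have le: "\<Phi> (prox s g y) \<le> \<Phi> u" for u
    by (simp add: is_arg_min_def not_less)
  show fin: "g (prox s g y) \<noteq> \<infinity>"
    using le[of u1] u1 by (auto simp: \<Phi>)
  show "1 / 2 * (norm (y - prox s g y))\<^sup>2 + s * real_of_ereal (g (prox s g y))
        \<le> 1 / 2 * (norm (y - u))\<^sup>2 + s * real_of_ereal (g u)" if "g u \<noteq> \<infinity>" for u
    using le[of u] that fin by (simp add: \<Phi>)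
qed

section \<open>Energy estimates for an accelerated step\<close>

text \<open>Add \<open>t - 1\<close> times \<open>prev\<close> to \<open>star\<close> and multiply
  by \<open>t\<close>. At \<open>t = 1\<close> the weight of \<open>prev\<close> vanishes, which is
  why it is asked for only when \<open>t > 1\<close>.\<close>

lemma accelerated_step_energy:
  fixes x y z xs :: "'a::real_inner"
  assumes "1 \<le> t"
    and star: "vz \<le> (1 - q) * (norm (y - xs))\<^sup>2 - (norm (z - xs))\<^sup>2 - a * (norm (z - y))\<^sup>2"
    and prev: "t > 1 \<Longrightarrow> vz - vx \<le> (1 - q) * (norm (y - x))\<^sup>2 - (norm (z - x))\<^sup>2 - a * (norm (z - y))\<^sup>2"
  shows "t\<^sup>2 * vz + (norm (t *\<^sub>R z - (t - 1) *\<^sub>R x - xs))\<^sup>2 + a * t\<^sup>2 * (norm (z - y))\<^sup>2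
      + q * (t * (t - 1) * (norm (y - x))\<^sup>2 + t * (norm (y - xs))\<^sup>2)
    \<le> (t\<^sup>2 - t) * vx + (norm (t *\<^sub>R y - (t - 1) *\<^sub>R x - xs))\<^sup>2"
proof -
  \<comment> \<open>With \<open>p = w - x\<close> and \<open>e = x - xs\<close> the vector is
    \<open>t *\<^sub>R p + e\<close>, an affine combination of \<open>w - xs\<close> and
    \<open>x - xs\<close>. Applied to \<open>w = z\<close> and to \<open>w = y\<close>, the identity
    produces both energies, and the terms in \<open>x - xs\<close> cancel.\<close>
  have *: "(norm (t *\<^sub>R w - (t - 1) *\<^sub>R x - xs))\<^sup>2
    = t * (t - 1) * (norm (w - x))\<^sup>2 + t * (norm (w - xs))\<^sup>2 - (t - 1) * (norm (x - xs))\<^sup>2" for w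
  proof -
    have "(norm (t *\<^sub>R p + e))\<^sup>2
      = t * (t - 1) * (norm p)\<^sup>2 + t * (norm (p + e))\<^sup>2 - (t - 1) * (norm e)\<^sup>2" for p e :: 'a
      unfolding power2_norm_eq_inner by (simp add: inner_add_left inner_add_right inner_commute
          power2_eq_square algebra_simps)
    from this[of "w - x" "x - xs"] show ?thesis
      by (simp add: algebra_simps)
  qed
  have "(t - 1) * (vz - vx)
    \<le> (t - 1) * ((1 - q) * (norm (y - x))\<^sup>2 - (norm (z - x))\<^sup>2 - a * (norm (z - y))\<^sup>2)"
    using prev \<open>1 \<le> t\<close> by (cases "t = 1") (auto intro!: mult_left_mono)
  with star have "t * (vz + (t - 1) * (vz - vx))
    \<le> t * ((1 - q) * (norm (y - xs))\<^sup>2 - (norm (z - xs))\<^sup>2 - a * (norm (z - y))\<^sup>2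
        + (t - 1) * ((1 - q) * (norm (y - x))\<^sup>2 - (norm (z - x))\<^sup>2 - a * (norm (z - y))\<^sup>2))"
    using \<open>1 \<le> t\<close> by (intro mult_left_mono) auto
  then show ?thesis
    unfolding * by (simp add: power2_eq_square algebra_simps)
qed

lemma norm_sum3_squared_le:
  fixes u v w :: "'a::real_inner"
  shows "(norm (u + v + w))\<^sup>2 \<le> 3 * ((norm u)\<^sup>2 + (norm v)\<^sup>2 + (norm w)\<^sup>2)"
proof -
  have "0 \<le> (norm (u - v))\<^sup>2 + (norm (v - w))\<^sup>2 + (norm (u - w))\<^sup>2"
    by simp
  then show ?thesis
    by (simp add: power2_norm_eq_inner inner_diff_left inner_diff_right inner_add_left
        inner_add_right inner_commute)
qed

text \<open>If \<open>D\<close> is the decrease of the energy from \<open>?F\<close> to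
  \<open>?E\<close> and \<open>a * q / 3 * ?E \<le> ?\<rho> * D\<close>, then
  \<open>?E \<le> ?\<rho> * (?E + D) \<le> ?\<rho> * ?F\<close>. So it suffices to dominate each
  part of \<open>?E\<close> by the squares collected in \<open>D\<close>.\<close>

lemma accelerated_step_contraction:
  fixes x y z xs :: "'a::real_inner"
  assumes "1 \<le> t" and q: "0 < q" and a: "0 < a" "a + q < 1"
    and star: "vz \<le> (1 - q) * (norm (y - xs))\<^sup>2 - (norm (z - xs))\<^sup>2 - a * (norm (z - y))\<^sup>2"
    and prev: "t > 1 \<Longrightarrow> vz - vx \<le> (1 - q) * (norm (y - x))\<^sup>2 - (norm (z - x))\<^sup>2 - a * (norm (z - y))\<^sup>2"
  shows "t\<^sup>2 * vz + (norm (t *\<^sub>R z - (t - 1) *\<^sub>R x - xs))\<^sup>2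
    \<le> (1 - a * q / 3) * ((t\<^sup>2 - t) * vx + (norm (t *\<^sub>R y - (t - 1) *\<^sub>R x - xs))\<^sup>2)"
proof -
  let ?E = "t\<^sup>2 * vz + (norm (t *\<^sub>R z - (t - 1) *\<^sub>R x - xs))\<^sup>2"
    and ?\<rho> = "1 - a * q / 3"
    and ?F = "(t\<^sup>2 - t) * vx + (norm (t *\<^sub>R y - (t - 1) *\<^sub>R x - xs))\<^sup>2"
  let ?e = "(norm (z - y))\<^sup>2" and ?X = "(norm (y - x))\<^sup>2" and ?Y = "(norm (y - xs))\<^sup>2"
  define D where "D = a * t\<^sup>2 * ?e + q * (t * (t - 1) * ?X + t * ?Y)"
  have dec: "?E + D \<le> ?F"
    using accelerated_step_energy[OF \<open>1 \<le> t\<close> star prev] by (simp add: D_def)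
  have "a * q < 1"
    using a q mult_strict_mono[of a 1 q 1] by simp
  \<comment> \<open>A Polyak-Lojasiewicz type bound: completing the square in \<open>star\<close>
    controls the function gap by the length of the proximal step alone.\<close>
  have qv: "q * vz \<le> (1 - q - a * q) * ?e"
  proof -
    have "q * vz \<le> q * ((1 - q) * ?Y - (norm (z - xs))\<^sup>2 - a * ?e)"
      using star q by simp
    also have "\<dots> = (1 - q - a * q) * ?e - (norm (q *\<^sub>R (y - xs) - (y - z)))\<^sup>2"
      unfolding power2_norm_eq_inner by (simp add: inner_diff_left inner_diff_right inner_commute
          power2_eq_square algebra_simps)
    finally show ?thesis
      by (smt (verit) zero_le_power2)
  qed
  \<comment> \<open>Splitting along the three squares available in \<open>D\<close> costs the factor
    3 that appears in the rate.\<close>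
  have w: "(norm (t *\<^sub>R z - (t - 1) *\<^sub>R x - xs))\<^sup>2 \<le> 3 * ((t - 1)\<^sup>2 * ?X + ?Y + t\<^sup>2 * ?e)"
  proof -
    have *: "t *\<^sub>R z - (t - 1) *\<^sub>R x - xs = (t - 1) *\<^sub>R (y - x) + (y - xs) + t *\<^sub>R (z - y)"
      by (simp add: algebra_simps)
    show ?thesis
      unfolding * using norm_sum3_squared_le[of "(t - 1) *\<^sub>R (y - x)" "y - xs" "t *\<^sub>R (z - y)"]
      by (simp add: power_mult_distrib)
  qed
  have "a * q / 3 * ?E \<le> ?\<rho> * D"
  proof -
    have "a * q / 3 * ?E = a / 3 * t\<^sup>2 * (q * vz)
        + a * q / 3 * (norm (t *\<^sub>R z - (t - 1) *\<^sub>R x - xs))\<^sup>2"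
      by (simp add: algebra_simps)
    also have "\<dots> \<le> a / 3 * t\<^sup>2 * ((1 - q - a * q) * ?e)
        + a * q / 3 * (3 * ((t - 1)\<^sup>2 * ?X + ?Y + t\<^sup>2 * ?e))"
      using qv w a q by (intro add_mono mult_left_mono) auto
    also have "\<dots> = ((1 + 2 * q - a * q) / 3) * (a * t\<^sup>2 * ?e)
        + a * (q * (t - 1)\<^sup>2 * ?X) + a * (q * ?Y)"
      by (simp add: field_simps)
    \<comment> \<open>Compared term by term. For the first,
      \<open>(1 + 2 * q - a * q) / 3 \<le> 1 - a * q / 3\<close> amounts to
      \<open>q \<le> 1\<close>; the other two follow from \<open>a \<le> 1 - q \<le> ?\<rho>\<close>
      together with \<open>1 \<le> t\<close>.\<close>
    also have "\<dots> \<le> ?\<rho> * (a * t\<^sup>2 * ?e) + ?\<rho> * (q * (t * (t - 1)) * ?X) + ?\<rho> * (q * t * ?Y)"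
    proof -
      have "q < 1" "a \<le> 1 - q" using a by auto
      have "a * q \<le> q" using a q by simp
      then have "a \<le> ?\<rho>" using \<open>a \<le> 1 - q\<close> q by linarith
      have "(t - 1)\<^sup>2 \<le> t * (t - 1)"
        using \<open>1 \<le> t\<close> by (simp add: power2_eq_square mult_right_mono)
      have "?\<rho> \<ge> 0" using \<open>a * q < 1\<close> by simp
      show ?thesis
        using \<open>q < 1\<close> \<open>a \<le> ?\<rho>\<close> \<open>(t - 1)\<^sup>2 \<le> t * (t - 1)\<close> \<open>?\<rho> \<ge> 0\<close> \<open>1 \<le> t\<close> a q
        by (intro add_mono mult_mono mult_nonneg_nonneg order.refl mult_left_mono) auto
    qed
    finally show ?thesis
      by (simp add: D_def algebra_simps)
  qed
  then have "?E \<le> ?\<rho> * (?E + D)"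
    by (simp add: algebra_simps)
  also have "\<dots> \<le> ?\<rho> * ?F"
    using dec \<open>a * q < 1\<close> by (intro mult_left_mono) auto
  finally show ?thesis .
qed

text \<open>Only a negative cross term \<open>?A\<close> can make the energy smaller than the
  squared distance. If the second alternative fails, the law of cosines gives
  \<open>- 2 * ?A \<le> 4 * q * ?h\<close>, and \<open>4 * (t - 1) \<le> t\<^sup>2\<close> lets the
  gap term absorb this. That inequality is the source of the 4 in \<open>1 + 4 * q\<close>.\<close>

lemma energy_controls_distance:
  fixes x z xs :: "'a::real_inner"
  assumes "1 \<le> t" and q: "0 < q" and growth: "q * (norm (z - xs))\<^sup>2 \<le> vz"
  shows "(norm (z - xs))\<^sup>2 \<le> t\<^sup>2 * vz + (norm (t *\<^sub>R z - (t - 1) *\<^sub>R x - xs))\<^sup>2 \<or>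
    (1 + 4 * q) * (norm (z - xs))\<^sup>2 \<le> (norm (x - xs))\<^sup>2"
proof (rule disjCI)
  let ?A = "(z - x) \<bullet> (z - xs)" and ?h = "(norm (z - xs))\<^sup>2"
  assume "\<not> (1 + 4 * q) * ?h \<le> (norm (x - xs))\<^sup>2"
  moreover have "(norm (x - xs))\<^sup>2 = ?h - 2 * ?A + (norm (z - x))\<^sup>2"
    by (simp add: power2_norm_eq_inner inner_diff_left inner_diff_right inner_commute)
  moreover have "0 \<le> (norm (z - x))\<^sup>2"
    by simp
  ultimately have "- 2 * ?A \<le> 4 * q * ?h"
    unfolding distrib_right mult_1 by linarith
  then have "(t - 1) * (- 2 * ?A) \<le> (t - 1) * (4 * q * ?h)"
    using \<open>1 \<le> t\<close> by (intro mult_left_mono) auto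
  also have "\<dots> = (4 * (t - 1)) * (q * ?h)"
    by simp
  also have "\<dots> \<le> t\<^sup>2 * (q * ?h)"
  proof (rule mult_right_mono)
    have "0 \<le> (t - 2)\<^sup>2" by simp
    then show "4 * (t - 1) \<le> t\<^sup>2" by (simp add: power2_eq_square algebra_simps)
  qed (use q in simp)
  also have "\<dots> \<le> t\<^sup>2 * vz"
    using growth by (intro mult_left_mono) auto
  finally have *: "0 \<le> t\<^sup>2 * vz + 2 * (t - 1) * ?A"
    by (simp add: algebra_simps)
  have "(norm (t *\<^sub>R z - (t - 1) *\<^sub>R x - xs))\<^sup>2 = (t - 1)\<^sup>2 * (norm (z - x))\<^sup>2 + 2 * (t - 1) * ?A + ?h"
    unfolding power2_norm_eq_inner by (simp add: inner_diff_left inner_diff_right inner_commute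
        power2_eq_square algebra_simps)
  then show "?h \<le> t\<^sup>2 * vz + (norm (t *\<^sub>R z - (t - 1) *\<^sub>R x - xs))\<^sup>2"
    using * by (smt (verit) zero_le_power2 mult_nonneg_nonneg)
qed

section \<open>The restarted method\<close>

lemma apg_params_ge_1:
  assumes "apg_params t" and "1 \<le> k"
  shows "1 \<le> t k"
  using \<open>1 \<le> k\<close>
proof (induction k rule: dec_induct)
  case (step k)
  then show ?case
    using assms(1) unfolding apg_params_def by (smt (verit) Suc_eq_plus1)
qed (use assms(1) in \<open>simp add: apg_params_def\<close>)

lemma apg_params_step:
  assumes "apg_params t" and "1 \<le> k"
  shows "t k < t (k + 1)" and "(t (k + 1))\<^sup>2 - t (k + 1) \<le> (t k)\<^sup>2"
  using assms by (auto simp: apg_params_def)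

section \<open>Proximal gradient steps for a composite objective\<close>

locale composite_problem =
  fixes f :: "'a::euclidean_space \<Rightarrow> real" and g :: "'a \<Rightarrow> ereal"
    and L \<mu> s :: real and xstar :: 'a
  assumes \<mu>_pos: "0 < \<mu>" and \<mu>_less: "\<mu> < L"
    and smooth: "smooth_with L f" and strong: "strongly_convex \<mu> f"
    and closed_g: "closed_fun g" and proper_g: "proper_fun g" and convex_g: "convex_fun g"
    and minimizer: "is_arg_min (composite f g) (\<lambda>_. True) xstar"
    and s_pos: "0 < s" and s_less: "s < 1 / L"
begin

abbreviation T :: "'a \<Rightarrow> 'a" where
  "T \<equiv> prox_grad f g s"

(* Meaningful only where g is finite: elsewhere real_of_ereal returns 0. *)
definition gap :: "'a \<Rightarrow> real" where
  "gap u = 2 * s * (f u + real_of_ereal (g u) - (f xstar + real_of_ereal (g xstar)))"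

lemma L_s_less_1: "L * s < 1"
  using s_less \<mu>_pos \<mu>_less by (simp add: field_simps)

lemma composite_eq:
  assumes "g u \<noteq> \<infinity>"
  shows "composite f g u = ereal (f u + real_of_ereal (g u))"
  using assms proper_g unfolding composite_def proper_fun_def by (cases "g u") auto

lemma minimizer_finite: "g xstar \<noteq> \<infinity>"
proof
  assume "g xstar = \<infinity>"
  moreover obtain u where "g u \<noteq> \<infinity>"
    using proper_g by (auto simp: proper_fun_def)
  ultimately show False
    using minimizer composite_eq[of u] by (auto simp: is_arg_min_def composite_def)
qed

lemma gap_nonneg:
  assumes "g u \<noteq> \<infinity>"
  shows "0 \<le> gap u"
proof -
  have "composite f g xstar \<le> composite f g u"
    using minimizer by (simp add: is_arg_min_def not_less)
  then show ?thesis
    using s_pos by (simp add: gap_def composite_eq assms minimizer_finite)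
qed

lemma gap_minimizer [simp]: "gap xstar = 0"
  by (simp add: gap_def)

text \<open>Smoothness bounds \<open>f u\<close> above, so \<open>m \<le> F(u)\<close> bounds
  \<open>g u\<close> below by a concave quadratic. In the proximal objective the terms linear in
  \<open>u - y\<close> cancel and the curvature \<open>(1 - L * s) / 2\<close> remains, which is
  positive. This is the coercivity that makes the proximal point exist.\<close>

lemma prox_grad_variational:
  shows "g (T y) \<noteq> \<infinity>"
    and "g u \<noteq> \<infinity> \<Longrightarrow>
      s * real_of_ereal (g (T y)) + (y - s *\<^sub>R gradient f y - T y) \<bullet> (u - T y) \<le> s * real_of_ereal (g u)"
proof -
  define y' where "y' = y - s *\<^sub>R gradient f y"
  define m where "m = f xstar + real_of_ereal (g xstar)"
  note epi = ereal_epigraph_iff[OF proper_g]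
  have coercive: "s * (m - f y) + s\<^sup>2 / 2 * (norm (gradient f y))\<^sup>2 + (1 - L * s) / 2 * (norm (u - y))\<^sup>2
      \<le> 1 / 2 * (norm (y' - u))\<^sup>2 + s * real_of_ereal (g u)" if "g u \<noteq> \<infinity>" for u
  proof -
    have "m \<le> f u + real_of_ereal (g u)"
      using gap_nonneg[OF that] s_pos by (simp add: gap_def m_def zero_le_mult_iff)
    with smooth_upper_bound[OF smooth, of u y]
    have "m - (f y + gradient f y \<bullet> (u - y) + L / 2 * (norm (u - y))\<^sup>2) \<le> real_of_ereal (g u)"
      by linarith
    then have "s * (m - (f y + gradient f y \<bullet> (u - y) + L / 2 * (norm (u - y))\<^sup>2))
        \<le> s * real_of_ereal (g u)"
      using s_pos by (intro mult_left_mono) auto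
    moreover have "(norm (y' - u))\<^sup>2 = (norm (u - y))\<^sup>2 + 2 * s * (gradient f y \<bullet> (u - y))
        + s\<^sup>2 * (norm (gradient f y))\<^sup>2"
    proof -
      have eq: "y' - u = - ((u - y) + s *\<^sub>R gradient f y)"
        by (simp add: y'_def)
      show ?thesis
        unfolding eq norm_minus_cancel power2_norm_eq_inner
        by (simp add: inner_add_left inner_add_right inner_commute power2_eq_square)
    qed
    ultimately show ?thesis
      by (simp add: field_simps)
  qed
  have "0 < (1 - L * s) / 2"
    using L_s_less_1 by simp
  note pm = prox_minimizes[OF closed_g proper_g s_pos this coercive]
  have T: "T y = prox s g y'"
    by (simp add: prox_grad_def y'_def)
  show fin: "g (T y) \<noteq> \<infinity>"
    using pm(1) by (simp add: T)
  show "s * real_of_ereal (g (T y)) + (y - s *\<^sub>R gradient f y - T y) \<bullet> (u - T y) \<le> s * real_of_ereal (g u)"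
    if u: "g u \<noteq> \<infinity>"
    unfolding y'_def[symmetric]
  proof (rule prox_variational[OF convex_g s_pos])
    fix v r
    assume "(v, r) \<in> ereal_epigraph g"
    then have "g v \<noteq> \<infinity>" "s * real_of_ereal (g v) \<le> s * r"
      using s_pos by (auto simp: epi)
    then show "1 / 2 * (norm (y' - T y))\<^sup>2 + s * real_of_ereal (g (T y))
        \<le> 1 / 2 * (norm (y' - v))\<^sup>2 + s * r"
      using pm(2)[of v] unfolding T by linarith
  qed (use fin u in \<open>auto simp: epi\<close>)
qed

text \<open>Strong convexity at \<open>u\<close>, smoothness at the new point and the variational
  inequality are added. After polarization the gradient terms cancel and only squared distances
  remain. Both \<open>u = x\<close> and \<open>u = xstar\<close> are used later.\<close>

lemma prox_grad_descent:
  assumes "g u \<noteq> \<infinity>"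
  shows "gap (T y) - gap u
    \<le> (1 - \<mu> * s) * (norm (y - u))\<^sup>2 - (norm (T y - u))\<^sup>2 - (1 - L * s) * (norm (T y - y))\<^sup>2"
proof -
  define z where "z = T y"
  let ?G = "\<lambda>u. real_of_ereal (g u)" and ?d = "gradient f y"
  have "f differentiable (at y)"
    using smooth by (simp add: smooth_with_def)
  note lower = strongly_convex_lower_bound[OF this strong, of u]
  note upper = smooth_upper_bound[OF smooth, of z y]
  have "f z - f u \<le> ?d \<bullet> (z - u) + L / 2 * (norm (z - y))\<^sup>2 - \<mu> / 2 * (norm (u - y))\<^sup>2"
    using lower upper by (simp add: inner_diff_right)
  then have "2 * s * (f z - f u)
      \<le> 2 * s * (?d \<bullet> (z - u) + L / 2 * (norm (z - y))\<^sup>2 - \<mu> / 2 * (norm (u - y))\<^sup>2)"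
    using s_pos by (intro mult_left_mono) auto
  moreover have "s * ?G z + (y - s *\<^sub>R ?d - z) \<bullet> (u - z) \<le> s * ?G u"
    using prox_grad_variational(2)[OF assms] by (simp add: z_def)
  moreover have "2 * ((y - s *\<^sub>R ?d - z) \<bullet> (u - z))
      = 2 * s * (?d \<bullet> (z - u)) - (norm (u - y))\<^sup>2 + (norm (z - u))\<^sup>2 + (norm (z - y))\<^sup>2"
    unfolding power2_norm_eq_inner
    by (simp add: inner_diff_left inner_diff_right inner_commute algebra_simps)
  ultimately show ?thesis
    unfolding z_def[symmetric] gap_def norm_minus_commute[of y u] by (simp add: algebra_simps)
qed

text \<open>Descent with both points equal to \<open>xstar\<close> bounds the squared displacement
  by minus a nonnegative gap.\<close>

lemma prox_grad_minimizer: "T xstar = xstar"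
proof -
  have "(norm (T xstar - xstar))\<^sup>2 + (1 - L * s) * (norm (T xstar - xstar))\<^sup>2 \<le> 0"
    using prox_grad_descent[OF minimizer_finite, of xstar]
      gap_nonneg[OF prox_grad_variational(1)[of xstar]] by simp
  moreover have "0 \<le> (1 - L * s) * (norm (T xstar - xstar))\<^sup>2"
    using L_s_less_1 by simp
  ultimately have "(norm (T xstar - xstar))\<^sup>2 \<le> 0"
    by linarith
  then show ?thesis
    by simp
qed

text \<open>Quadratic growth is the descent inequality started at the fixed point
  \<open>xstar\<close>: the step does not move, so the left side is \<open>- gap u\<close>.\<close>

lemma gap_growth:
  assumes "g u \<noteq> \<infinity>"
  shows "\<mu> * s * (norm (u - xstar))\<^sup>2 \<le> gap u"
  using prox_grad_descent[OF assms, of xstar]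
  by (simp add: prox_grad_minimizer norm_minus_commute algebra_simps)

section \<open>The rate and the invariant of the iteration\<close>

definition rate :: real where
  "rate = 1 - (1 - L * s) * \<mu> * s / 3"

lemma \<mu>_s_bounds: "0 < \<mu> * s" "\<mu> * s < L * s" "\<mu> * s < 1"
proof -
  show "0 < \<mu> * s" "\<mu> * s < L * s"
    using \<mu>_pos \<mu>_less s_pos by auto
  then show "\<mu> * s < 1"
    using L_s_less_1 by linarith
qed

lemma rate_bounds: "1 - \<mu> * s \<le> rate" "0 < rate" "rate < 1" "1 \<le> (1 + 4 * (\<mu> * s)) * rate"
proof -
  define q a where "q = \<mu> * s" and "a = 1 - L * s"
  have qa: "0 < q" "q < 1" "0 < a" "a < 1"
    using \<mu>_s_bounds L_s_less_1 by (auto simp: q_def a_def)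
  have rate: "rate = 1 - a * q / 3"
    by (simp add: rate_def a_def q_def)
  have aq: "0 < a * q" "a * q \<le> q"
    using qa by auto
  show "1 - \<mu> * s \<le> rate" "0 < rate" "rate < 1"
    unfolding rate q_def[symmetric] using aq qa by linarith+
  have "1 - q / 3 \<le> rate"
    unfolding rate using aq by simp
  then have "(1 + 4 * q) * (1 - q / 3) \<le> (1 + 4 * q) * rate"
    using qa by (intro mult_left_mono) auto
  moreover have "q * q \<le> q"
    using qa by simp
  \<comment> \<open>The product expands to \<open>1 + (11 * q - 4 * q * q) / 3\<close>.\<close>
  then have "1 \<le> (1 + 4 * q) * (1 - q / 3)"
    using qa by (simp add: algebra_simps)
  ultimately show "1 \<le> (1 + 4 * (\<mu> * s)) * rate"
    by (simp add: q_def)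
qed

text \<open>Contraction of one plain proximal gradient step. It serves the restarts, the very first
  iteration and the final bound on function values.\<close>

lemma gap_distance_prox_grad:
  "gap (T y) + (norm (T y - xstar))\<^sup>2 \<le> (1 - \<mu> * s) * (norm (y - xstar))\<^sup>2"
proof -
  have "0 \<le> (1 - L * s) * (norm (T y - y))\<^sup>2"
    using L_s_less_1 by simp
  then show ?thesis
    using prox_grad_descent[OF minimizer_finite, of y] by simp
qed

text \<open>The first iteration gains \<open>1 - \<mu> * s\<close>, every later one
  \<open>rate\<close>. The value at 0 is separate because truncated subtraction would claim the
  first gain already for \<open>x0\<close>.\<close>

definition dist_bound :: "'a \<Rightarrow> nat \<Rightarrow> real" where
  "dist_bound x0 k = (if k = 0 then 1 else (1 - \<mu> * s) * rate ^ (k - 1)) * (norm (x0 - xstar))\<^sup>2"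

lemma dist_bound_Suc:
  assumes "0 < k"
  shows "dist_bound x0 (Suc k) = rate * dist_bound x0 k"
  using assms by (cases k) (auto simp: dist_bound_def)

lemma dist_bound_nonneg: "0 \<le> dist_bound x0 k"
  using rate_bounds \<mu>_s_bounds by (auto simp: dist_bound_def)

lemma dist_bound_Suc_ge: "(1 - \<mu> * s) * dist_bound x0 k \<le> dist_bound x0 (Suc k)"
proof (cases "k = 0")
  case False
  then show ?thesis
    using rate_bounds(1) dist_bound_nonneg by (simp only: dist_bound_Suc mult_right_mono)
qed (simp add: dist_bound_def)

lemma dist_bound_le: "dist_bound x0 k \<le> rate ^ k * (norm (x0 - xstar))\<^sup>2"
proof (cases k)
  case (Suc m)
  have "(1 - \<mu> * s) * rate ^ m \<le> rate * rate ^ m"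
    using rate_bounds by (intro mult_right_mono) auto
  then show ?thesis
    using Suc by (auto simp: dist_bound_def intro: mult_right_mono)
qed (simp add: dist_bound_def)

text \<open>The energy is that of the state before the next iteration, hence the weight
  \<open>(t j)\<^sup>2 - t j\<close> on the gap. Since \<open>g x0\<close> may be infinite,
  finiteness is claimed only for \<open>0 < k\<close>; at \<open>k = 0\<close> the counter is 1, and
  \<open>t 1 = 1\<close> removes the meaningless \<open>gap x0\<close>.\<close>

definition apg_invariant :: "(nat \<Rightarrow> real) \<Rightarrow> 'a \<Rightarrow> nat \<Rightarrow> 'a \<times> 'a \<times> nat \<Rightarrow> bool" where
  "apg_invariant t x0 k = (\<lambda>(x, y, j). 1 \<le> j \<and> (k = 0 \<longrightarrow> j = 1 \<and> x = x0 \<and> y = x0) \<and>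
     (0 < k \<longrightarrow> g x \<noteq> \<infinity>) \<and>
     ((t j)\<^sup>2 - t j) * gap x + (norm (t j *\<^sub>R y - (t j - 1) *\<^sub>R x - xstar))\<^sup>2 \<le> dist_bound x0 k \<and>
     (norm (x - xstar))\<^sup>2 \<le> dist_bound x0 k)"

lemma apg_invariant_step:
  assumes t: "apg_params t" and inv: "apg_invariant t x0 k (x, y, j)"
  shows "apg_invariant t x0 (Suc k) (apg_step f g s t (x, y, j))"
proof -
  have j: "1 \<le> j" and k0: "k = 0 \<Longrightarrow> j = 1 \<and> x = x0 \<and> y = x0"
    and fin: "0 < k \<Longrightarrow> g x \<noteq> \<infinity>"
    and energy: "((t j)\<^sup>2 - t j) * gap x + (norm (t j *\<^sub>R y - (t j - 1) *\<^sub>R x - xstar))\<^sup>2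
      \<le> dist_bound x0 k"
    and dist: "(norm (x - xstar))\<^sup>2 \<le> dist_bound x0 k"
    using inv by (auto simp: apg_invariant_def)
  have t1: "t 1 = 1"
    using t by (simp add: apg_params_def)
  define z where "z = T y"
  have finT: "g (T v) \<noteq> \<infinity>" for v
    by (rule prox_grad_variational)
  show ?thesis
  proof (cases "(z - x) \<bullet> (y - z) > 0")
    case True
    have "(norm (T x - xstar))\<^sup>2 \<le> (1 - \<mu> * s) * (norm (x - xstar))\<^sup>2"
      using gap_distance_prox_grad[of x] gap_nonneg[OF finT] by (smt (verit))
    also have "\<dots> \<le> (1 - \<mu> * s) * dist_bound x0 k"
      using dist \<mu>_s_bounds by (intro mult_left_mono) auto
    also have "\<dots> \<le> dist_bound x0 (Suc k)"
      by (rule dist_bound_Suc_ge)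
    finally have "(norm (T x - xstar))\<^sup>2 \<le> dist_bound x0 (Suc k)" .
    \<comment> \<open>After a restart \<open>y = x\<close> and \<open>t 1 = 1\<close>, so the energy
      clause collapses to the distance bound just shown.\<close>
    with True show ?thesis
      using finT t1 by (simp add: apg_invariant_def apg_step_def Let_def z_def)
  next
    case False
    define E where "E = (t j)\<^sup>2 * gap z + (norm (t j *\<^sub>R z - (t j - 1) *\<^sub>R x - xstar))\<^sup>2"
    have "1 \<le> t j" and "1 \<le> t (j + 1)"
      using apg_params_ge_1[OF t] j by auto
    have gz: "0 \<le> gap z"
      unfolding z_def by (rule gap_nonneg[OF finT])
    have "E \<le> dist_bound x0 (Suc k) \<and> (norm (z - xstar))\<^sup>2 \<le> dist_bound x0 (Suc k)"
    proof (cases "k = 0")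
      case True
      then have "E \<le> dist_bound x0 (Suc k)"
        using gap_distance_prox_grad[of x0] k0 t1 by (simp add: E_def z_def dist_bound_def)
      moreover have "E = gap z + (norm (z - xstar))\<^sup>2"
        using True k0 t1 by (simp add: E_def)
      ultimately show ?thesis
        using gz by simp
    next
      case False
      then have fx: "g x \<noteq> \<infinity>"
        using fin by simp
      have "E \<le> (1 - (1 - L * s) * (\<mu> * s) / 3) *
          (((t j)\<^sup>2 - t j) * gap x + (norm (t j *\<^sub>R y - (t j - 1) *\<^sub>R x - xstar))\<^sup>2)"
        unfolding E_def z_def
        using \<open>1 \<le> t j\<close> \<mu>_s_bounds L_s_less_1 prox_grad_descent[OF minimizer_finite, of y]
          prox_grad_descent[OF fx, of y]
        by (intro accelerated_step_contraction) auto
      also have "\<dots> \<le> rate * dist_bound x0 k"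
        unfolding rate_def mult.assoc[symmetric]
        using energy rate_bounds(2) by (intro mult_left_mono) (auto simp: rate_def)
      finally have E: "E \<le> dist_bound x0 (Suc k)"
        using False by (simp add: dist_bound_Suc)
      \<comment> \<open>The second alternative of \<open>energy_controls_distance\<close>: the
        distance itself shrinks by \<open>1 / (1 + 4 * (\<mu> * s))\<close>, which is at most
        \<open>rate\<close>.\<close>
      have "(norm (z - xstar))\<^sup>2 \<le> dist_bound x0 (Suc k)"
        if "(1 + 4 * (\<mu> * s)) * (norm (z - xstar))\<^sup>2 \<le> (norm (x - xstar))\<^sup>2"
      proof -
        have "1 * dist_bound x0 k \<le> (1 + 4 * (\<mu> * s)) * rate * dist_bound x0 k"
          using rate_bounds(4) dist_bound_nonneg by (rule mult_right_mono)
        with that dist have "(1 + 4 * (\<mu> * s)) * (norm (z - xstar))\<^sup>2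
            \<le> (1 + 4 * (\<mu> * s)) * (rate * dist_bound x0 k)"
          by (simp add: mult.assoc)
        then show ?thesis
          using \<mu>_s_bounds False by (simp add: dist_bound_Suc)
      qed
      moreover have "\<mu> * s * (norm (z - xstar))\<^sup>2 \<le> gap z"
        unfolding z_def by (rule gap_growth[OF finT])
      ultimately show ?thesis
        using E energy_controls_distance[of "t j" "\<mu> * s" z xstar "gap z" x] \<open>1 \<le> t j\<close> \<mu>_s_bounds
        unfolding E_def by linarith
    qed
    moreover have "((t (j + 1))\<^sup>2 - t (j + 1)) * gap z
        + (norm (t (j + 1) *\<^sub>R (z + ((t j - 1) / t (j + 1)) *\<^sub>R (z - x)) - (t (j + 1) - 1) *\<^sub>R z - xstar))\<^sup>2 \<le> E"
    proof -
      \<comment> \<open>The extrapolation coefficient is chosen to make this identity hold, so the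
        norm term of the energy carries over unchanged. The condition on \<open>t\<close> takes care
        of the gap term, since \<open>gap z\<close> is nonnegative.\<close>
      have "t (j + 1) *\<^sub>R (z + ((t j - 1) / t (j + 1)) *\<^sub>R (z - x)) - (t (j + 1) - 1) *\<^sub>R z - xstar
        = t j *\<^sub>R z - (t j - 1) *\<^sub>R x - xstar"
        using \<open>1 \<le> t (j + 1)\<close> by (simp add: scaleR_add_right) (simp add: algebra_simps)
      moreover have "((t (j + 1))\<^sup>2 - t (j + 1)) * gap z \<le> (t j)\<^sup>2 * gap z"
        using apg_params_step(2)[OF t j] gz by (rule mult_right_mono)
      ultimately show ?thesis
        by (simp add: E_def)
    qed
    ultimately show ?thesis
      using False finT[of y] by (simp add: apg_invariant_def apg_step_def Let_def z_def)
  qed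
qed

lemma apg_invariant:
  assumes "apg_params t"
  shows "apg_invariant t x0 k (apg_state f g s t x0 k)"
proof (induction k)
  case 0
  then show ?case
    using assms by (simp add: apg_invariant_def apg_params_def dist_bound_def)
next
  case (Suc k)
  then show ?case
    using apg_invariant_step[OF assms] by (cases "apg_state f g s t x0 k") auto
qed

section \<open>Linear convergence of the iterates and the function values\<close>

lemma apg_x_bound:
  assumes "apg_params t"
  shows "(norm (apg_x f g s t x0 k - xstar))\<^sup>2 \<le> dist_bound x0 k"
  using apg_invariant[OF assms, of x0 k] unfolding apg_invariant_def apg_x_def
  by (auto simp: case_prod_unfold)

lemma apg_x_finite:
  assumes "apg_params t" and "0 < k"
  shows "g (apg_x f g s t x0 k) \<noteq> \<infinity>"
  using apg_invariant[OF assms(1), of x0 k] assms(2) unfolding apg_invariant_def apg_x_def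
  by (auto simp: case_prod_unfold)

text \<open>Hides the counter: once the distances are bounded, all that matters about the momentum
  is \<open>0 \<le> \<beta> \<le> 1\<close>, and \<open>x\<close> always arises as \<open>T\<close>
  of the previous \<open>x\<close> or \<open>y\<close>.\<close>

lemma apg_step_cases:
  assumes "apg_params t"
  obtains (restart) "apg_x f g s t x0 (Suc k) = T (apg_x f g s t x0 k)"
      "apg_y f g s t x0 (Suc k) = apg_x f g s t x0 (Suc k)"
  | (extrapolate) \<beta> where "0 \<le> \<beta>" "\<beta> \<le> 1"
      "apg_x f g s t x0 (Suc k) = T (apg_y f g s t x0 k)"
      "apg_y f g s t x0 (Suc k)
        = apg_x f g s t x0 (Suc k) + \<beta> *\<^sub>R (apg_x f g s t x0 (Suc k) - apg_x f g s t x0 k)"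
proof -
  obtain x y j where st: "apg_state f g s t x0 k = (x, y, j)"
    by (cases "apg_state f g s t x0 k")
  have j: "1 \<le> j"
    using apg_invariant[OF assms, of x0 k] by (simp add: st apg_invariant_def)
  define \<beta> where "\<beta> = (t j - 1) / t (j + 1)"
  have "1 \<le> t j" "t j < t (j + 1)"
    using apg_params_ge_1[OF assms] apg_params_step[OF assms] j by auto
  then have "0 \<le> \<beta>" "\<beta> \<le> 1"
    by (simp_all add: \<beta>_def)
  show thesis
  proof (cases "(T y - x) \<bullet> (y - T y) > 0")
    case True
    then show thesis
      by (intro restart) (simp_all add: apg_x_def apg_y_def st apg_step_def Let_def)
  next
    case False
    with \<open>0 \<le> \<beta>\<close> \<open>\<beta> \<le> 1\<close> show thesis
      by (intro extrapolate[of \<beta>])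
        (simp_all add: apg_x_def apg_y_def st apg_step_def Let_def \<beta>_def)
  qed
qed

text \<open>\<open>y\<close> lies on the line through the last two iterates, so their bounds carry
  over. The older one has index \<open>k - 1\<close>, hence the division by
  \<open>rate\<close>.\<close>

lemma apg_y_bound:
  assumes "apg_params t"
  shows "(norm (apg_y f g s t x0 k - xstar))\<^sup>2 \<le> 10 * (norm (x0 - xstar))\<^sup>2 / rate * rate ^ k"
proof (cases k)
  case 0
  then show ?thesis
    using rate_bounds by (simp add: apg_y_def field_simps mult_mono)
next
  case (Suc m)
  define h where "h = (norm (x0 - xstar))\<^sup>2"
  define x x' where "x = apg_x f g s t x0 m" and "x' = apg_x f g s t x0 (Suc m)"
  have x: "(norm (x - xstar))\<^sup>2 \<le> rate ^ m * h"
    using apg_x_bound[OF assms] dist_bound_le unfolding x_def h_def by (rule order_trans)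
  have "(norm (x' - xstar))\<^sup>2 \<le> rate ^ Suc m * h"
    using apg_x_bound[OF assms] dist_bound_le unfolding x'_def h_def by (rule order_trans)
  also have "\<dots> \<le> rate ^ m * h"
    using rate_bounds unfolding h_def by (intro mult_right_mono power_decreasing) auto
  finally have x': "(norm (x' - xstar))\<^sup>2 \<le> rate ^ m * h" .
  have "(norm (apg_y f g s t x0 (Suc m) - xstar))\<^sup>2 \<le> 10 * (rate ^ m * h)"
  using assms
  proof (cases rule: apg_step_cases[where k = m and ?x0.0 = x0])
    case restart
    then show ?thesis
      using order_trans[OF zero_le_power2 x'] x' unfolding x'_def by simp
  next
    case (extrapolate \<beta>)
    define A B where "A = norm (x' - xstar)" and "B = norm (x - xstar)"
    have "apg_y f g s t x0 (Suc m) - xstar = (1 + \<beta>) *\<^sub>R (x' - xstar) - \<beta> *\<^sub>R (x - xstar)"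
      unfolding extrapolate(4) x_def x'_def by (simp add: algebra_simps)
    then have "norm (apg_y f g s t x0 (Suc m) - xstar) \<le> (1 + \<beta>) * A + \<beta> * B"
      using norm_triangle_ineq4[of "(1 + \<beta>) *\<^sub>R (x' - xstar)" "\<beta> *\<^sub>R (x - xstar)"] extrapolate(1)
      by (simp add: A_def B_def)
    also have "\<dots> \<le> 2 * A + 1 * B"
      using extrapolate(1,2) by (intro add_mono mult_right_mono) (auto simp: A_def B_def)
    finally have "(norm (apg_y f g s t x0 (Suc m) - xstar))\<^sup>2 \<le> (2 * A + B)\<^sup>2"
      by (intro power_mono) auto
    \<comment> \<open>The parallelogram identity for \<open>2 * A\<close> and \<open>B\<close>; the
      constant 10 is \<open>8 + 2\<close>.\<close>
    also have "\<dots> = 8 * A\<^sup>2 + 2 * B\<^sup>2 - (2 * A - B)\<^sup>2"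
      by (simp add: power2_eq_square algebra_simps)
    also have "\<dots> \<le> 8 * (rate ^ m * h) + 2 * (rate ^ m * h)"
      using x x' zero_le_power2[of "2 * A - B"] unfolding A_def B_def by linarith
    finally show ?thesis
      by (simp add: mult.commute)
  qed
  then show ?thesis
    using rate_bounds Suc by (simp add: h_def mult_ac)
qed

text \<open>The gap after a step from \<open>v\<close> is at most the squared distance of
  \<open>v\<close> to \<open>xstar\<close>, and \<open>v\<close> is the previous \<open>x\<close> or
  \<open>y\<close>, both already bounded.\<close>

lemma apg_gap_bound:
  assumes "apg_params t"
  shows "gap (apg_x f g s t x0 (Suc k)) \<le> 10 * (norm (x0 - xstar))\<^sup>2 / rate * rate ^ k"
proof -
  have gap_T: "gap (T v) \<le> (norm (v - xstar))\<^sup>2" for v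
  proof -
    have "(1 - \<mu> * s) * (norm (v - xstar))\<^sup>2 \<le> 1 * (norm (v - xstar))\<^sup>2"
      using \<mu>_s_bounds by (intro mult_right_mono) auto
    then show ?thesis
      using gap_distance_prox_grad[of v] zero_le_power2[of "norm (T v - xstar)"] by linarith
  qed
  show ?thesis
  using assms
  proof (cases rule: apg_step_cases[where k = k and ?x0.0 = x0])
    case restart
    have "(norm (apg_x f g s t x0 k - xstar))\<^sup>2 \<le> rate ^ k * (norm (x0 - xstar))\<^sup>2"
      using apg_x_bound[OF assms] dist_bound_le by (rule order_trans)
    also have "\<dots> = (norm (x0 - xstar))\<^sup>2 * rate ^ k"
      by simp
    also have "\<dots> \<le> 10 * (norm (x0 - xstar))\<^sup>2 / rate * rate ^ k"
      using rate_bounds by (intro mult_right_mono) (auto simp: field_simps mult_mono)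
    finally show ?thesis
      using gap_T[of "apg_x f g s t x0 k"] unfolding restart(1) by linarith
  next
    case extrapolate
    then show ?thesis
      using gap_T[of "apg_y f g s t x0 k"] apg_y_bound[OF assms, of x0 k] by simp
  qed
qed

lemma apg_R_linear:
  assumes "apg_params t"
  shows "\<exists>C. \<forall>k\<ge>1. (norm (apg_y f g s t x0 k - xstar))\<^sup>2 \<le> C * rate ^ k \<and>
    composite f g (apg_x f g s t x0 k) - composite f g xstar \<le> ereal (C * rate ^ k)"
proof -
  define c where "c = 10 * (norm (x0 - xstar))\<^sup>2 / rate"
  \<comment> \<open>One constant for both claims: the first summand is for \<open>y\<close>; the
    second undoes the factor \<open>2 * s\<close> in \<open>gap\<close> and the index shift in
    \<open>apg_gap_bound\<close>.\<close>
  define C where "C = c + c / (2 * s * rate)"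
  have c: "0 \<le> c" "0 \<le> c / (2 * s * rate)"
    using rate_bounds s_pos by (auto simp: c_def)
  have "(norm (apg_y f g s t x0 k - xstar))\<^sup>2 \<le> C * rate ^ k \<and>
    composite f g (apg_x f g s t x0 k) - composite f g xstar \<le> ereal (C * rate ^ k)"
    if k1: "1 \<le> k" for k
  proof
    let ?x = "apg_x f g s t x0 k"
    obtain m where k: "k = Suc m"
      using k1 by (cases k) auto
    have "(norm (apg_y f g s t x0 k - xstar))\<^sup>2 \<le> c * rate ^ k"
      unfolding c_def by (rule apg_y_bound[OF assms])
    also have "\<dots> \<le> C * rate ^ k"
      unfolding C_def using c rate_bounds by (intro mult_right_mono) auto
    finally show "(norm (apg_y f g s t x0 k - xstar))\<^sup>2 \<le> C * rate ^ k" .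
    have "gap ?x / (2 * s) \<le> c * rate ^ m / (2 * s)"
      using apg_gap_bound[OF assms, of x0 m] s_pos unfolding k c_def by (intro divide_right_mono) auto
    also have "\<dots> = c / (2 * s * rate) * rate ^ k"
      using rate_bounds by (simp add: k)
    also have "\<dots> \<le> C * rate ^ k"
      unfolding C_def using c rate_bounds by (intro mult_right_mono) auto
    finally have "gap ?x / (2 * s) \<le> C * rate ^ k" .
    \<comment> \<open>Both values are finite, since \<open>k\<close> is at least 1, so the
      extended-real difference is a real one.\<close>
    moreover have "composite f g ?x - composite f g xstar = ereal (gap ?x / (2 * s))"
      using apg_x_finite[OF assms, of k x0] k s_pos
      by (simp add: composite_eq minimizer_finite gap_def)
    ultimately show "composite f g ?x - composite f g xstar \<le> ereal (C * rate ^ k)"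
      by simp
  qed
  then show ?thesis
    by blast
qed

end

theorem theorem2:
  fixes f :: "real ^ 'n \<Rightarrow> real"
    and g :: "real ^ 'n \<Rightarrow> ereal"
    and L \<mu> s \<rho> :: real
    and t :: "nat \<Rightarrow> real"
    and x0 xstar :: "real ^ 'n"
    and x y :: "nat \<Rightarrow> real ^ 'n"
  assumes "0 < \<mu>" and "\<mu> < L"
    and "smooth_with L f" and "strongly_convex \<mu> f"
    and "closed_fun g" and "proper_fun g" and "convex_fun g"
    and "is_arg_min (composite f g) (\<lambda>_. True) xstar"
    and "0 < s" and "s < 1 / L"
    and "apg_params t"
  defines "x \<equiv> apg_x f g s t x0"
    and "y \<equiv> apg_y f g s t x0"
    and "\<rho> \<equiv> 1 - (1 - L * s) * \<mu> * s / 3"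
  shows "(\<forall>k\<ge>1. (norm (x k - xstar))\<^sup>2 \<le> (1 - \<mu> * s) * \<rho> ^ (k - 1) * (norm (x0 - xstar))\<^sup>2) \<and>
    (\<exists>C::real. \<forall>k\<ge>1. (norm (y k - xstar))\<^sup>2 \<le> C * \<rho> ^ k \<and>
       composite f g (x k) - composite f g xstar \<le> ereal (C * \<rho> ^ k))"
proof -
  interpret composite_problem f g L \<mu> s xstar
    using assms by unfold_locales
  have \<rho>: "\<rho> = rate"
    by (simp add: \<rho>_def rate_def)
  show ?thesis
  proof (intro conjI allI impI)
    fix k :: nat
    assume "1 \<le> k"
    then show "(norm (x k - xstar))\<^sup>2 \<le> (1 - \<mu> * s) * \<rho> ^ (k - 1) * (norm (x0 - xstar))\<^sup>2"
      using apg_x_bound[OF \<open>apg_params t\<close>, of x0 k] by (simp add: dist_bound_def x_def \<rho>)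
  next
    show "\<exists>C::real. \<forall>k\<ge>1. (norm (y k - xstar))\<^sup>2 \<le> C * \<rho> ^ k \<and>
       composite f g (x k) - composite f g xstar \<le> ereal (C * \<rho> ^ k)"
      unfolding x_def y_def \<rho> by (rule apg_R_linear[OF \<open>apg_params t\<close>])
  qed
qed

end
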